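(* Let $n,a\ge 1$ be integers and let $1\le i,j\le n$. Let $P_a(i,j)$ be the probability that the card at position $i$ moves to position $j$ after an $a$-shuffle of a deck of $n$ cards. Then $$P_a(i,j)=\frac{1}{a^n}\sum_{k=1}^{a}\sum_{r=l}^{u}\binom{j-1}{r}\binom{n-j}{i-r-1}\,k^{r}(a-k)^{j-1-r}(k-1)^{i-1-r}(a-k+1)^{(n-j)-(i-r-1)},$$ where $l=\max(0,(i+j)-(n+1))$ and $u=\min(i-1,j-1)$.
   Context: Positions are numbered $1,\dots,n$ from the top of the deck. The convention $0^0=1$ is used. $a$-shuffle of $n$ cards: the deck is cut into $a$ consecutive packets of sizes $A_1,\dots,A_a\ge 0$ (packet $1$ on top, empty packets allowed), $A_1+\cdots+A_a=n$, with probability $a^{-n}\binom{n}{A_1,\dots,A_a}$; the packets are then riffled together by dropping cards one at a time from the bottoms of the packets, the next card coming from a given packet with probability proportional to its current size (equivalently, all interleavings preserving the order within each packet are equally likely). *)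

theory Defs
  imports "HOL-Probability.Probability"
begin

text \<open>
  Decks, packets and piles are lists of cards with the top card first; a cut of a deck of
  \<open>n\<close> cards is the list of the sizes of its \<open>a\<close> packets, the top packet first.
\<close>

definition cuts :: "nat \<Rightarrow> nat \<Rightarrow> nat list set" where
  "cuts a n = {A. length A = a \<and> sum_list A = n}"

definition multinomial :: "nat \<Rightarrow> nat list \<Rightarrow> real" where
  "multinomial n A = fact n / (\<Prod>m\<leftarrow>A. fact m)"

definition cut_pmf :: "nat \<Rightarrow> nat \<Rightarrow> nat list pmf" where
  "cut_pmf a n = embed_pmf (\<lambda>A. if A \<in> cuts a n then multinomial n A / real a ^ n else 0)"

lemma cuts_0: "cuts 0 n = (if n = 0 then {[]} else {})"
  by (auto simp: cuts_def)

lemma cuts_Suc: "cuts (Suc a) n = (\<Union>m\<le>n. (#) m ` cuts a (n - m))"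
  by (auto simp: cuts_def length_Suc_conv image_iff)

lemma finite_cuts [simp]: "finite (cuts a n)"
  by (induction a arbitrary: n) (auto simp: cuts_0 cuts_Suc)

lemma sum_inverse_facts: "(\<Sum>A\<in>cuts a n. 1 / (\<Prod>m\<leftarrow>A. fact m)) = real a ^ n / fact n"
proof (induction a arbitrary: n)
  case 0
  then show ?case by (simp add: cuts_0)
next
  case (Suc a)
  have "(\<Sum>A\<in>cuts (Suc a) n. 1 / (\<Prod>m\<leftarrow>A. fact m))
      = (\<Sum>m\<le>n. \<Sum>A\<in>(#) m ` cuts a (n - m). 1 / (\<Prod>m\<leftarrow>A. fact m))" (is "?L = _")
    unfolding cuts_Suc by (rule sum.UNION_disjoint) auto
  also have "\<dots> = (\<Sum>m\<le>n. 1 / fact m * (real a ^ (n - m) / fact (n - m)))"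
    by (intro sum.cong refl) (simp add: sum.reindex sum_distrib_left flip: Suc.IH)
  also have "\<dots> = (\<Sum>m\<le>n. real (n choose m) * 1 ^ m * real a ^ (n - m)) / fact n"
    unfolding sum_divide_distrib
    by (intro sum.cong refl) (simp add: binomial_fact field_simps)
  also have "\<dots> = (1 + real a) ^ n / fact n"
    by (simp only: binomial_ring)
  finally show ?case by simp
qed

lemma pmf_cut_pmf:
  assumes "a \<ge> 1"
  shows "pmf (cut_pmf a n) A = (if A \<in> cuts a n then multinomial n A / real a ^ n else 0)"
  unfolding cut_pmf_def
proof (rule pmf_embed_pmf)
  let ?f = "\<lambda>A. if A \<in> cuts a n then multinomial n A / real a ^ n else 0"
  show nonneg: "0 \<le> ?f A" for A
    by (auto simp: multinomial_def intro!: divide_nonneg_nonneg mult_nonneg_nonneg prod_list_nonneg)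
  have "(\<integral>\<^sup>+ A. ennreal (?f A) \<partial>count_space UNIV) = (\<Sum>A\<in>cuts a n. ennreal (?f A))"
    by (rule nn_integral_count_space'[OF finite_cuts]) auto
  also have "\<dots> = ennreal (\<Sum>A\<in>cuts a n. ?f A)"
    by (rule sum_ennreal[OF nonneg])
  also have "(\<Sum>A\<in>cuts a n. ?f A)
      = fact n / real a ^ n * (\<Sum>A\<in>cuts a n. 1 / (\<Prod>m\<leftarrow>A. fact m))"
    unfolding sum_distrib_left by (intro sum.cong refl) (simp add: multinomial_def)
  also have "\<dots> = 1"
    unfolding sum_inverse_facts using assms by simp
  finally show "(\<integral>\<^sup>+ A. ennreal (?f A) \<partial>count_space UNIV) = 1"
    by simp
qed

fun packets :: "nat list \<Rightarrow> 'c list \<Rightarrow> 'c list list" where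
  "packets [] d = []"
| "packets (m # A) d = take m d # packets A (drop m d)"


text \<open>
  The index of a packet chosen with probability proportional to its current size, namely
  the packet containing a uniformly chosen remaining card.
\<close>

definition choose_packet :: "'c list list \<Rightarrow> nat pmf" where
  "choose_packet ps =
     map_pmf fst (pmf_of_set (SIGMA p:{..<length ps}. {..<length (ps ! p)}))"

lemma pmf_choose_packet:
  assumes "p < length ps" and "concat ps \<noteq> []"
  shows "pmf (choose_packet ps) p = real (length (ps ! p)) / real (\<Sum>q\<leftarrow>ps. length q)"
proof -
  let ?S = "SIGMA p:{..<length ps}. {..<length (ps ! p)}"
  have card: "card ?S = (\<Sum>q\<leftarrow>ps. length q)"
    by (simp add: sum_list_sum_nth atLeast0LessThan)
  have "card ?S \<noteq> 0"
    unfolding card using assms(2) by (simp flip: length_concat)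
  then have "?S \<noteq> {}" "finite ?S"
    by (metis card.empty, simp)
  moreover have "?S \<inter> fst -` {p} = {p} \<times> {..<length (ps ! p)}"
    using assms(1) by auto
  ultimately show ?thesis
    unfolding choose_packet_def
    by (simp add: pmf_map measure_pmf_of_set card card_cartesian_product
        del: card_SigmaI)
qed

text \<open>
  \<open>riffle m ps d\<close> drops the bottom cards of \<open>m\<close> successively chosen packets of
  \<open>ps\<close> on top of the pile \<open>d\<close>.
\<close>

fun riffle :: "nat \<Rightarrow> 'c list list \<Rightarrow> 'c list \<Rightarrow> 'c list pmf" where
  "riffle 0 ps d = return_pmf d"
| "riffle (Suc m) ps d =
     bind_pmf (choose_packet ps) (\<lambda>p. riffle m (ps[p := butlast (ps ! p)]) (last (ps ! p) # d))"

definition a_shuffle :: "nat \<Rightarrow> 'c list \<Rightarrow> 'c list pmf" where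
  "a_shuffle a d =
     bind_pmf (cut_pmf a (length d)) (\<lambda>A. riffle (length d) (packets A d) [])"

text \<open>
  Each card of the deck \<open>[1..<Suc n]\<close> is labelled by its position before the shuffle.
  List indices start at 0, positions at 1.
\<close>

definition move_prob :: "nat \<Rightarrow> nat \<Rightarrow> nat \<Rightarrow> nat \<Rightarrow> real" where
  "move_prob n a i j = measure_pmf.prob (a_shuffle a [1..<Suc n]) {d. d ! (j - 1) = i}"

end

theory Submission
  imports Defs
begin

text \<open>
  Label each position of the shuffled deck with the packet that its card came from. This gives a
  word of length \<open>n\<close> over the \<open>a\<close> packets, and the word determines the shuffled deck: packets keep
  their internal order, so the card at a position labelled \<open>k\<close> was preceded in the original deck
  by exactly the cards with a smaller label and by those with label \<open>k\<close> that are still above it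
  (\<open>source\<close>, \<open>merge_packets\<close>).

  The word is uniformly distributed over all \<open>a\<close>-ary words of length \<open>n\<close> (\<open>labels_uniform\<close>). The
  letters of a word \<open>w\<close> force the cut: packet \<open>p\<close> must have as many cards as \<open>w\<close> has letters \<open>p\<close>.
  Once the sizes \<open>A\<^sub>1, \<dots>, A\<^sub>a\<close> are fixed, dropping cards with probability proportional to packet
  size makes every compatible word occur with probability \<open>A\<^sub>1! \<cdots> A\<^sub>a! / n!\<close> (\<open>pmf_label_pmf\<close>), the
  inverse of the multinomial coefficient in the probability of the cut. The product is \<open>1 / a\<^sup>n\<close>,
  whatever \<open>w\<close> is.

  It remains to count words (\<open>card_source_eq\<close>). If position \<open>j\<close> has label \<open>k\<close>, then its card
  came from position \<open>i\<close> iff the number \<open>r\<close> of labels \<open>\<le> k\<close> among the \<open>j - 1\<close> positions above it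
  and the number of labels \<open>< k\<close> among the \<open>n - j\<close> positions below it add up to \<open>i - 1\<close>. The two
  parts of the word are chosen independently, and each is counted by a binomial formula
  (\<open>card_words_with\<close>).
\<close>

section \<open>The word of packet choices\<close>

text \<open>
  The choices made by \<^const>\<open>riffle\<close>, without the cards: the word whose \<open>t\<close>-th letter is the
  packet that supplies the \<open>t\<close>-th card of the resulting pile. Cards are dropped from the bottom
  up, so the packet chosen first is the last letter.
\<close>

primrec label_pmf :: "nat \<Rightarrow> 'c list list \<Rightarrow> nat list pmf" where
  "label_pmf 0 ps = return_pmf []"
| "label_pmf (Suc m) ps = bind_pmf (choose_packet ps)
     (\<lambda>p. map_pmf (\<lambda>w. w @ [p]) (label_pmf m (ps[p := butlast (ps ! p)])))"

definition interleavings :: "'c list list \<Rightarrow> nat list set" where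
  "interleavings ps =
     {w. set w \<subseteq> {..<length ps} \<and> (\<forall>p<length ps. count_list w p = length (ps ! p))}"

text \<open>
  A card that is the \<open>c\<close>-th of its packet lands on the \<open>c\<close>-th occurrence of that packet's label,
  since riffling preserves the order within a packet.
\<close>

definition merge :: "'c list list \<Rightarrow> nat list \<Rightarrow> 'c list" where
  "merge ps w = map (\<lambda>t. ps ! (w ! t) ! count_list (take t w) (w ! t)) [0..<length w]"

lemma length_interleaving:
  assumes "w \<in> interleavings ps"
  shows "length w = (\<Sum>q\<leftarrow>ps. length q)"
proof -
  have "length w = (\<Sum>p<length ps. count_list w p)"
    using assms by (intro sum_count_set[symmetric]) (auto simp: interleavings_def)
  also have "\<dots> = (\<Sum>p<length ps. length (ps ! p))"
    using assms by (intro sum.cong) (auto simp: interleavings_def)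
  finally show ?thesis
    by (simp add: sum_list_sum_nth atLeast0LessThan)
qed

lemma interleavings_snoc_iff:
  assumes "p < length ps"
  shows "w @ [p] \<in> interleavings ps \<longleftrightarrow>
     ps ! p \<noteq> [] \<and> w \<in> interleavings (ps[p := butlast (ps ! p)])"
proof -
  have "count_list (w @ [p]) p = length (ps ! p) \<longleftrightarrow>
      ps ! p \<noteq> [] \<and> count_list w p = length (butlast (ps ! p))"
    by (cases "ps ! p" rule: rev_cases) auto
  then show ?thesis
    using assms by (auto simp: interleavings_def nth_list_update)
qed

lemma sum_length_butlast:
  assumes "p < length ps" and "ps ! p \<noteq> []"
  shows "Suc (\<Sum>q\<leftarrow>ps[p := butlast (ps ! p)]. length q) = (\<Sum>q\<leftarrow>ps. length q)"
proof -
  have eq: "ps = take p ps @ ps ! p # drop (Suc p) ps"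
    using assms(1) by (rule id_take_nth_drop)
  have "ps[p := butlast (ps ! p)] = take p ps @ butlast (ps ! p) # drop (Suc p) ps"
    using assms(1) by (rule upd_conv_take_nth_drop)
  moreover have "Suc (length (butlast (ps ! p))) = length (ps ! p)"
    using assms(2) by simp
  moreover have "(\<Sum>q\<leftarrow>ps. length q) =
      (\<Sum>q\<leftarrow>take p ps. length q) + (length (ps ! p) + (\<Sum>q\<leftarrow>drop (Suc p) ps. length q))"
    by (subst eq) simp
  ultimately show ?thesis
    by (simp del: length_butlast)
qed

lemma set_pmf_choose_packet:
  assumes "concat ps \<noteq> []" and "p \<in> set_pmf (choose_packet ps)"
  shows "p < length ps" and "ps ! p \<noteq> []"
proof -
  let ?S = "SIGMA p:{..<length ps}. {..<length (ps ! p)}"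
  obtain q where "q \<in> set ps" "q \<noteq> []"
    using assms(1) by auto
  then have "?S \<noteq> {}"
    by (fastforce simp: in_set_conv_nth)
  then have "set_pmf (pmf_of_set ?S) = ?S"
    by (intro set_pmf_of_set) auto
  then have "p \<in> fst ` ?S"
    using assms(2) by (simp only: choose_packet_def set_map_pmf)
  then show "p < length ps" "ps ! p \<noteq> []"
    by auto
qed

text \<open>
  An empty packet is never chosen while cards remain, so after as many drops as there are cards
  each packet has been chosen exactly as often as it has cards.
\<close>

lemma set_label_pmf:
  assumes "m = (\<Sum>q\<leftarrow>ps. length q)"
  shows "set_pmf (label_pmf m ps) \<subseteq> interleavings ps"
  using assms
proof (induction m arbitrary: ps)
  case 0
  then show ?case by (auto simp: interleavings_def)
next
  case (Suc m)
  then have ne: "concat ps \<noteq> []"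
    by (metis length_concat list.size(3) nat.distinct(1))
  show ?case
  proof
    fix v assume "v \<in> set_pmf (label_pmf (Suc m) ps)"
    then obtain p w where p: "p \<in> set_pmf (choose_packet ps)"
      and w: "w \<in> set_pmf (label_pmf m (ps[p := butlast (ps ! p)]))" and v: "v = w @ [p]"
      by auto
    note p = set_pmf_choose_packet[OF ne p]
    have "m = (\<Sum>q\<leftarrow>ps[p := butlast (ps ! p)]. length q)"
      using Suc.prems sum_length_butlast[OF p] by linarith
    with Suc.IH w p v show "v \<in> interleavings ps"
      by (auto simp: interleavings_snoc_iff)
  qed
qed

lemma count_list_take_less:
  assumes "t < length w"
  shows "count_list (take t w) (w ! t) < count_list w (w ! t)"
proof -
  have "count_list w (w ! t) = count_list (take t w @ w ! t # drop (Suc t) w) (w ! t)"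
    using id_take_nth_drop[OF assms] by simp
  then show ?thesis by simp
qed

lemma merge_snoc:
  assumes "p < length ps" and "w @ [p] \<in> interleavings ps"
  shows "merge ps (w @ [p]) = merge (ps[p := butlast (ps ! p)]) w @ [last (ps ! p)]"
proof -
  have ne: "ps ! p \<noteq> []" and w: "w \<in> interleavings (ps[p := butlast (ps ! p)])"
    using assms by (simp_all add: interleavings_snoc_iff)
  have cnt: "count_list w p = length (ps ! p) - 1"
    using w assms(1) by (auto simp: interleavings_def)
  have "ps ! (w ! t) ! count_list (take t w) (w ! t) =
      ps[p := butlast (ps ! p)] ! (w ! t) ! count_list (take t w) (w ! t)"
    if "t < length w" for t
    using count_list_take_less[OF that] cnt assms(1)
    by (cases "w ! t = p") (auto simp: nth_butlast)
  then show ?thesis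
    using ne cnt by (auto simp: merge_def nth_append last_conv_nth)
qed

text \<open>
  This separates the randomness of riffling from the cards: the pile is a function of the packets
  and of the word of choices.
\<close>

lemma riffle_eq_merge:
  assumes "m = (\<Sum>q\<leftarrow>ps. length q)"
  shows "riffle m ps d = map_pmf (\<lambda>w. merge ps w @ d) (label_pmf m ps)"
  using assms
proof (induction m arbitrary: ps d)
  case 0
  then show ?case by (simp add: merge_def)
next
  case (Suc m)
  then have ne: "concat ps \<noteq> []"
    by (metis length_concat list.size(3) nat.distinct(1))
  show ?case
    unfolding riffle.simps label_pmf.simps map_bind_pmf pmf.map_comp o_def
  proof (intro bind_pmf_cong refl)
    fix p assume "p \<in> set_pmf (choose_packet ps)"
    note p = set_pmf_choose_packet[OF ne this]
    let ?ps = "ps[p := butlast (ps ! p)]"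
    have m: "m = (\<Sum>q\<leftarrow>?ps. length q)"
      using Suc.prems sum_length_butlast[OF p] by linarith
    have "riffle m ?ps (last (ps ! p) # d) =
        map_pmf (\<lambda>w. merge ?ps w @ last (ps ! p) # d) (label_pmf m ?ps)"
      using m by (rule Suc.IH)
    also have "\<dots> = map_pmf (\<lambda>w. merge ps (w @ [p]) @ d) (label_pmf m ?ps)"
      using set_label_pmf[OF m] p
      by (intro map_pmf_cong refl) (auto simp: merge_snoc interleavings_snoc_iff)
    finally show "riffle m ?ps (last (ps ! p) # d) =
        map_pmf (\<lambda>w. merge ps (w @ [p]) @ d) (label_pmf m ?ps)" .
  qed
qed

lemma pmf_bind_snoc:
  "pmf (bind_pmf M (\<lambda>p. map_pmf (\<lambda>w. w @ [p]) (N p))) (w @ [p]) = pmf M p * pmf (N p) w"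
proof -
  have "pmf (map_pmf (\<lambda>w. w @ [q]) (N q)) (w @ [p]) = indicator {p} q * pmf (N p) w" for q
  proof (cases "q = p")
    case True
    have "inj (\<lambda>w. w @ [p])" by (simp add: inj_def)
    then have "pmf (map_pmf (\<lambda>w. w @ [p]) (N p)) (w @ [p]) = pmf (N p) w"
      by (rule pmf_map_inj'[of "\<lambda>w. w @ [p]"])
    with True show ?thesis by simp
  next
    case False
    then have "w @ [p] \<notin> set_pmf (map_pmf (\<lambda>w. w @ [q]) (N q))" by auto
    with False show ?thesis by (simp add: set_pmf_eq)
  qed
  then show ?thesis
    by (simp add: pmf_bind measure_pmf_single)
qed

lemma prod_list_fact_butlast:
  assumes "p < length ps" and "ps ! p \<noteq> []"
  shows "(\<Prod>q\<leftarrow>ps. fact (length q)) =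
    real (length (ps ! p)) * (\<Prod>q\<leftarrow>ps[p := butlast (ps ! p)]. fact (length q))"
proof -
  have eq: "ps = take p ps @ ps ! p # drop (Suc p) ps"
    using assms(1) by (rule id_take_nth_drop)
  have upd: "ps[p := butlast (ps ! p)] = take p ps @ butlast (ps ! p) # drop (Suc p) ps"
    using assms(1) by (rule upd_conv_take_nth_drop)
  have "fact (length (ps ! p)) = real (length (ps ! p)) * fact (length (butlast (ps ! p)))"
    using assms(2) by (simp add: fact_reduce)
  moreover have "(\<Prod>q\<leftarrow>ps. fact (length q)) = (\<Prod>q\<leftarrow>take p ps. fact (length q)) *
      ((fact (length (ps ! p)) :: real) * (\<Prod>q\<leftarrow>drop (Suc p) ps. fact (length q)))"
    by (subst eq) simp
  ultimately show ?thesis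
    by (simp add: upd del: length_butlast)
qed

text \<open>
  All interleavings are equally likely: a drop from packet \<open>p\<close> when \<open>m\<close> cards remain contributes
  the factor \<open>length (ps ! p) / m\<close>, and in whatever order the packets are chosen, the numerators
  multiply up to the factorials of the packet sizes and the denominators to the factorial of the
  number of cards.
\<close>

lemma pmf_label_pmf:
  assumes "w \<in> interleavings ps"
  shows "pmf (label_pmf (length w) ps) w = (\<Prod>q\<leftarrow>ps. fact (length q)) / fact (length w)"
  using assms
proof (induction w arbitrary: ps rule: rev_induct)
  case Nil
  then have "\<forall>q\<in>set ps. q = []"
    by (fastforce simp: interleavings_def in_set_conv_nth)
  then have "(\<Prod>q\<leftarrow>ps. fact (length q)) = (1::real)"
    by (induction ps) auto
  then show ?case by simp
next
  case (snoc p w)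
  have p: "p < length ps"
    using snoc.prems by (simp add: interleavings_def)
  then have ne: "ps ! p \<noteq> []" and w: "w \<in> interleavings (ps[p := butlast (ps ! p)])"
    using snoc.prems by (simp_all add: interleavings_snoc_iff)
  have "concat ps \<noteq> []"
    using ne nth_mem[OF p] by (simp only: concat_eq_Nil_conv) blast
  then have "pmf (choose_packet ps) p = real (length (ps ! p)) / real (Suc (length w))"
    using p length_interleaving[OF snoc.prems] by (simp add: pmf_choose_packet)
  then show ?case
    unfolding length_append_singleton label_pmf.simps pmf_bind_snoc snoc.IH[OF w]
      prod_list_fact_butlast[OF p ne]
    by simp
qed

section \<open>Uniformity of the labels over a random cut\<close>

lemma length_packets [simp]: "length (packets A d) = length A"
  by (induction A arbitrary: d) auto

lemma map_length_packets:
  "sum_list A \<le> length d \<Longrightarrow> map length (packets A d) = A"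
  by (induction A arbitrary: d) auto

lemma nth_packets:
  assumes "sum_list A \<le> length d" and "p < length A" and "c < A ! p"
  shows "packets A d ! p ! c = d ! (sum_list (take p A) + c)"
  using assms
  by (induction A arbitrary: p d) (auto simp: nth_Cons less_Suc_eq_0_disj add.assoc split: nat.split)

definition words :: "nat \<Rightarrow> nat \<Rightarrow> nat list set" where
  "words a n = {w. set w \<subseteq> {..<a} \<and> length w = n}"

lemma finite_words [simp]: "finite (words a n)"
  unfolding words_def by (rule finite_lists_length_eq) simp

lemma card_words: "card (words a n) = a ^ n"
  unfolding words_def by (simp add: card_lists_length_eq)

text \<open>
  Each word over the \<open>a\<close> packets is compatible with exactly one cut, namely its letter counts.
  This is why the sum over cuts below collapses to a single term.
\<close>

lemma interleavings_packets:
  assumes "A \<in> cuts a n" and "length d = n"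
  shows "w \<in> interleavings (packets A d) \<longleftrightarrow> w \<in> words a n \<and> A = map (count_list w) [0..<a]"
proof -
  have A: "length A = a" "sum_list A = n"
    using assms(1) by (auto simp: cuts_def)
  have len: "map length (packets A d) = A"
    using A assms(2) by (simp add: map_length_packets)
  then have nth: "length (packets A d ! p) = A ! p" if "p < a" for p
    using that A by (metis length_packets nth_map)
  have "w \<in> words a n" if "w \<in> interleavings (packets A d)"
    using that length_interleaving[OF that] len A by (auto simp: words_def interleavings_def)
  then show ?thesis
    using A nth by (auto simp: interleavings_def words_def list_eq_iff_nth_eq)
qed

lemma counts_in_cuts:
  assumes "w \<in> words a n"
  shows "map (count_list w) [0..<a] \<in> cuts a n"
proof -
  have "sum_list (map (count_list w) [0..<a]) = (\<Sum>p<a. count_list w p)"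
    by (simp add: interv_sum_list_conv_sum_set_nat atLeast0LessThan)
  also have "\<dots> = n"
    using assms by (subst sum_count_set) (auto simp: words_def)
  finally show ?thesis by (simp add: cuts_def)
qed

text \<open>
  The multinomial weight of the unique compatible cut cancels against the probability of the word
  given that cut, and \<open>1 / a ^ n\<close> remains.
\<close>

lemma labels_uniform:
  assumes "a \<ge> 1" and d: "length d = n"
  shows "bind_pmf (cut_pmf a n) (\<lambda>A. label_pmf n (packets A d)) = pmf_of_set (words a n)"
proof (rule pmf_eqI)
  fix w
  have ne: "words a n \<noteq> {}"
    using card_words[of a n] assms(1) by auto
  have pmf0: "pmf (label_pmf n (packets A d)) w = 0"
    if "A \<in> cuts a n" "w \<notin> interleavings (packets A d)" for A
  proof -
    have "map length (packets A d) = A" "sum_list A = n"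
      using that(1) d by (auto simp: cuts_def intro: map_length_packets)
    then have "set_pmf (label_pmf n (packets A d)) \<subseteq> interleavings (packets A d)"
      by (intro set_label_pmf) simp
    with that(2) show ?thesis by (auto simp: set_pmf_eq)
  qed
  have "pmf (bind_pmf (cut_pmf a n) (\<lambda>A. label_pmf n (packets A d))) w =
      (\<Sum>A\<in>cuts a n. pmf (label_pmf n (packets A d)) w * pmf (cut_pmf a n) A)"
    unfolding pmf_bind
    by (rule integral_measure_pmf_real)
       (use assms in \<open>auto simp: set_pmf_eq pmf_cut_pmf split: if_splits\<close>)
  also have "\<dots> = (if w \<in> words a n then 1 / real a ^ n else 0)"
  proof (cases "w \<in> words a n")
    case True
    let ?A = "map (count_list w) [0..<a]"
    have A: "?A \<in> cuts a n"
      using True by (rule counts_in_cuts)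
    then have w: "w \<in> interleavings (packets ?A d)"
      using True d by (simp add: interleavings_packets)
    have len: "map length (packets ?A d) = ?A"
      using A d by (intro map_length_packets) (simp add: cuts_def)
    have "(\<Prod>q\<leftarrow>packets ?A d. fact (length q)) = (\<Prod>m\<leftarrow>map length (packets ?A d). fact m :: real)"
      by (simp add: o_def)
    then have "pmf (label_pmf n (packets ?A d)) w = (\<Prod>m\<leftarrow>?A. fact m) / fact n"
      unfolding len using pmf_label_pmf[OF w] True by (simp add: words_def)
    moreover have "(\<Prod>m\<leftarrow>?A. fact m) \<noteq> (0::real)"
      by (auto simp: prod_list_zero_iff)
    moreover have "(\<Sum>A\<in>cuts a n. pmf (label_pmf n (packets A d)) w * pmf (cut_pmf a n) A) =
        (\<Sum>A\<in>{?A}. pmf (label_pmf n (packets A d)) w * pmf (cut_pmf a n) A)"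
      using A pmf0 d by (intro sum.mono_neutral_right) (auto simp: interleavings_packets)
    ultimately show ?thesis
      using True A assms(1) by (simp add: pmf_cut_pmf multinomial_def del: map_map)
  next
    case False
    then show ?thesis
      using pmf0 d by (auto simp: interleavings_packets intro!: sum.neutral)
  qed
  also have "\<dots> = pmf (pmf_of_set (words a n)) w"
    using ne by (simp add: card_words)
  finally show "pmf (bind_pmf (cut_pmf a n) (\<lambda>A. label_pmf n (packets A d))) w =
      pmf (pmf_of_set (words a n)) w" .
qed

section \<open>The shuffled deck as a function of the labels\<close>

text \<open>
  The index in the original deck of the card at index \<open>t\<close> of the shuffled deck. The packets of
  smaller label lie above its packet in the original deck and contribute the first summand; the
  second one is the index of the card within its packet.
\<close>

definition source :: "nat list \<Rightarrow> nat \<Rightarrow> nat" where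
  "source w t = length (filter (\<lambda>q. q < w ! t) w) + count_list (take t w) (w ! t)"

lemma length_filter_le_eq:
  fixes k :: "'b::linorder"
  shows "length (filter (\<lambda>q. q \<le> k) w) = length (filter (\<lambda>q. q < k) w) + count_list w k"
  by (induction w) auto

lemma sum_count_list_less:
  fixes p :: nat
  shows "(\<Sum>q<p. count_list w q) = length (filter (\<lambda>q. q < p) w)"
  by (induction p) (simp_all add: less_Suc_eq_le length_filter_le_eq)

lemma merge_packets:
  assumes "length d = n" and A: "A \<in> cuts a n" and w: "w \<in> interleavings (packets A d)"
  shows "merge (packets A d) w = map (\<lambda>t. d ! source w t) [0..<n]"
proof -
  have w': "w \<in> words a n" and Aeq: "A = map (count_list w) [0..<a]"
    using w interleavings_packets[OF A assms(1)] by auto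
  have "packets A d ! (w ! t) ! count_list (take t w) (w ! t) = d ! source w t"
    if t: "t < length w" for t
  proof -
    have p: "w ! t < a"
      using w' nth_mem[OF t] unfolding words_def by blast
    have "packets A d ! (w ! t) ! count_list (take t w) (w ! t) =
        d ! (sum_list (take (w ! t) A) + count_list (take t w) (w ! t))"
      using A assms(1) p count_list_take_less[OF t]
      by (intro nth_packets) (auto simp: cuts_def Aeq)
    also have "sum_list (take (w ! t) A) = (\<Sum>q<w ! t. count_list w q)"
      using p by (simp add: Aeq take_map interv_sum_list_conv_sum_set_nat atLeast0LessThan)
    finally show ?thesis
      by (simp add: source_def sum_count_list_less)
  qed
  then show ?thesis
    using w' by (auto simp: merge_def words_def)
qed

theorem a_shuffle_eq_uniform_words:
  assumes "a \<ge> 1"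
  shows "a_shuffle a d =
    map_pmf (\<lambda>w. map (\<lambda>t. d ! source w t) [0..<length d]) (pmf_of_set (words a (length d)))"
proof -
  let ?n = "length d"
  let ?f = "\<lambda>w. map (\<lambda>t. d ! source w t) [0..<?n]"
  have "riffle ?n (packets A d) [] = map_pmf ?f (label_pmf ?n (packets A d))"
    if "A \<in> set_pmf (cut_pmf a ?n)" for A
  proof -
    have A: "A \<in> cuts a ?n"
      using that assms by (auto simp: set_pmf_eq pmf_cut_pmf split: if_splits)
    then have "map length (packets A d) = A" "sum_list A = ?n"
      by (auto simp: cuts_def intro: map_length_packets)
    then have n: "?n = (\<Sum>q\<leftarrow>packets A d. length q)"
      by simp
    show ?thesis
      unfolding riffle_eq_merge[OF n]
      using set_label_pmf[OF n] A by (intro map_pmf_cong refl) (auto simp: merge_packets)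
  qed
  then have "a_shuffle a d =
      bind_pmf (cut_pmf a ?n) (\<lambda>A. map_pmf ?f (label_pmf ?n (packets A d)))"
    unfolding a_shuffle_def by (intro bind_pmf_cong refl) auto
  also have "\<dots> = map_pmf ?f (pmf_of_set (words a ?n))"
    unfolding labels_uniform[OF assms refl, symmetric] by (simp add: map_bind_pmf)
  finally show ?thesis .
qed

section \<open>Counting words\<close>

text \<open>
  Letters equal to \<open>k\<close> count only if they occur before the distinguished position, which is
  why the comparison is weak on the left and strict on the right.
\<close>

lemma source_append_Cons:
  "source (x @ k # y) (length x) =
     length (filter (\<lambda>q. q \<le> k) x) + length (filter (\<lambda>q. q < k) y)"
  by (simp add: source_def length_filter_le_eq)

lemma source_less:
  assumes "t < length w"
  shows "source w t < length w"
proof -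
  let ?x = "take t w" and ?k = "w ! t" and ?y = "drop (Suc t) w"
  have "w = ?x @ ?k # ?y" and x: "length ?x = t"
    using id_take_nth_drop[OF assms] assms by simp_all
  then have "source w t = length (filter (\<lambda>q. q \<le> ?k) ?x) + length (filter (\<lambda>q. q < ?k) ?y)"
    using source_append_Cons[of ?x ?k ?y] by simp
  also have "\<dots> \<le> length ?x + length ?y"
    by (intro add_mono length_filter_le)
  finally show ?thesis using assms x by simp
qed

definition words_with :: "nat \<Rightarrow> nat \<Rightarrow> (nat \<Rightarrow> bool) \<Rightarrow> nat \<Rightarrow> nat list set" where
  "words_with a m P r = {w \<in> words a m. length (filter P w) = r}"

text \<open>
  Splitting off the first letter gives the recurrence of the binomial coefficients, weighted by
  the numbers of letters with and without the property.
\<close>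

lemma card_words_with:
  "card (words_with a m P r) =
     (m choose r) * card {s. s < a \<and> P s} ^ r * card {s. s < a \<and> \<not> P s} ^ (m - r)"
proof (induction m arbitrary: r)
  case 0
  have "words_with a 0 P r = (if r = 0 then {[]} else {})"
    by (auto simp: words_with_def words_def)
  then show ?case by simp
next
  case (Suc m)
  let ?T = "{s. s < a \<and> P s}" and ?F = "{s. s < a \<and> \<not> P s}"
  let ?cons = "\<lambda>(s, w). s # w"
  have fin: "finite (words_with a m P r)" for r
    by (simp add: words_with_def)
  have inj: "inj_on ?cons X" for X :: "(nat \<times> nat list) set"
    by (auto simp: inj_on_def)
  have F: "card (?cons ` (?F \<times> words_with a m P r)) = card ?F * card (words_with a m P r)" for r
    by (simp add: card_image[OF inj] card_cartesian_product)
  have T: "card (?cons ` (?T \<times> words_with a m P r)) = card ?T * card (words_with a m P r)" for r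
    by (simp add: card_image[OF inj] card_cartesian_product)
  show ?case
  proof (cases r)
    case 0
    have "words_with a (Suc m) P 0 = ?cons ` (?F \<times> words_with a m P 0)"
      by (auto simp: words_with_def words_def length_Suc_conv image_iff split: if_splits)
    then show ?thesis
      by (simp add: F Suc.IH 0)
  next
    case (Suc r')
    have "words_with a (Suc m) P (Suc r') =
        ?cons ` (?T \<times> words_with a m P r') \<union> ?cons ` (?F \<times> words_with a m P (Suc r'))"
      by (auto simp: words_with_def words_def length_Suc_conv image_iff split: if_splits)
    moreover have "card (?cons ` (?T \<times> words_with a m P r') \<union>
          ?cons ` (?F \<times> words_with a m P (Suc r'))) =
        card (?cons ` (?T \<times> words_with a m P r')) +
        card (?cons ` (?F \<times> words_with a m P (Suc r')))"
      using fin by (intro card_Un_disjoint) auto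
    ultimately have eq: "card (words_with a (Suc m) P r) =
        card ?T * card (words_with a m P r') + card ?F * card (words_with a m P r)"
      by (simp add: F T Suc)
    show ?thesis
    proof (cases "r \<le> m")
      case True
      then have "m - r' = Suc (m - r)" using Suc by simp
      then show ?thesis
        unfolding eq Suc.IH using Suc by (simp add: algebra_simps)
    next
      case False
      then show ?thesis
        unfolding eq Suc.IH using Suc by (simp add: algebra_simps)
    qed
  qed
qed

text \<open>
  The bounds on \<open>r\<close> say that \<open>r\<close> is at most the number of positions above and that \<open>i - 1 - r\<close> is
  between \<open>0\<close> and the number of positions below.
\<close>

lemma card_source_eq:
  assumes "1 \<le> i" and "1 \<le> j" and "j \<le> n"
  shows "card {w \<in> words a n. source w (j - 1) = i - 1} =
    (\<Sum>k<a. \<Sum>r=max 0 ((i + j) - (n + 1))..min (i - 1) (j - 1).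
      card (words_with a (j - 1) (\<lambda>q. q \<le> k) r) *
      card (words_with a (n - j) (\<lambda>q. q < k) (i - 1 - r)))"
proof -
  let ?R = "{max 0 ((i + j) - (n + 1))..min (i - 1) (j - 1)}"
  let ?X = "\<lambda>k r. words_with a (j - 1) (\<lambda>q. q \<le> k) r"
  let ?Y = "\<lambda>k r. words_with a (n - j) (\<lambda>q. q < k) (i - 1 - r)"
  let ?D = "SIGMA k:{..<a}. SIGMA r:?R. ?X k r \<times> ?Y k r"
  let ?g = "\<lambda>(k, r, x, y). x @ k # y"
  have "{w \<in> words a n. source w (j - 1) = i - 1} = ?g ` ?D"
  proof (intro equalityI subsetI)
    fix w assume "w \<in> {w \<in> words a n. source w (j - 1) = i - 1}"
    then have w: "set w \<subseteq> {..<a}" "length w = n" and src: "source w (j - 1) = i - 1"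
      by (auto simp: words_def)
    define x k y where "x = take (j - 1) w" and "k = w ! (j - 1)" and "y = drop j w"
    define r where "r = length (filter (\<lambda>q. q \<le> k) x)"
    have weq: "w = x @ k # y"
      using id_take_nth_drop[of "j - 1" w] w assms by (simp add: x_def k_def y_def)
    have lx: "length x = j - 1" and ly: "length y = n - j"
      using w assms by (auto simp: x_def y_def)
    have sum: "r + length (filter (\<lambda>q. q < k) y) = i - 1"
      using source_append_Cons[of x k y] src by (simp add: weq r_def lx)
    have "r \<le> j - 1" "length (filter (\<lambda>q. q < k) y) \<le> n - j"
      using length_filter_le[of _ x] length_filter_le[of _ y] lx ly by (auto simp: r_def)
    then have "r \<in> ?R" using sum assms by auto
    moreover have "x \<in> ?X k r" "y \<in> ?Y k r" "k < a"
      using w lx ly sum by (auto simp: words_with_def words_def weq r_def)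
    ultimately have "(k, r, x, y) \<in> ?D" by auto
    then show "w \<in> ?g ` ?D"
      by (rule rev_image_eqI) (simp add: weq)
  next
    fix w assume "w \<in> ?g ` ?D"
    then obtain k r x y where w: "w = x @ k # y" and "k < a" and r: "r \<in> ?R"
      and x: "x \<in> ?X k r" and y: "y \<in> ?Y k r"
      by auto
    moreover have "length x = j - 1" using x by (auto simp: words_with_def words_def)
    ultimately show "w \<in> {w \<in> words a n. source w (j - 1) = i - 1}"
      using source_append_Cons[of x k y] assms by (auto simp: words_with_def words_def)
  qed
  moreover have "inj_on ?g ?D"
    by (auto simp: inj_on_def words_with_def words_def)
  ultimately have "card {w \<in> words a n. source w (j - 1) = i - 1} = card ?D"
    by (simp add: card_image)
  moreover have "finite (words_with a m P r)" for m P r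
    by (simp add: words_with_def)
  ultimately show ?thesis
    by (simp add: card_cartesian_product)
qed

section \<open>The transition probabilities of a single card\<close>

theorem proposition2p1:
  fixes n a i j :: nat
  assumes "n \<ge> 1" and "a \<ge> 1"
    and "1 \<le> i" and "i \<le> n" and "1 \<le> j" and "j \<le> n"
  shows "move_prob n a i j =
    1 / real a ^ n *
    (\<Sum>k=1..a. \<Sum>r=max 0 ((i + j) - (n + 1))..min (i - 1) (j - 1).
      real ((j - 1) choose r) * real ((n - j) choose (i - r - 1))
      * real k ^ r * real (a - k) ^ (j - 1 - r)
      * real (k - 1) ^ (i - 1 - r) * real (a - k + 1) ^ ((n - j) - (i - r - 1)))"
proof -
  let ?d = "[1..<Suc n]"
  let ?f = "\<lambda>w. map (\<lambda>t. ?d ! source w t) [0..<n]"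
  let ?R = "{max 0 ((i + j) - (n + 1))..min (i - 1) (j - 1)}"
  have ne: "words a n \<noteq> {}"
    using card_words[of a n] assms(2) by auto
  have src: "source w (j - 1) < n" if "w \<in> words a n" for w
    using that source_less[of "j - 1" w] assms by (simp add: words_def)
  \<comment> \<open>The card with original index \<open>s\<close> carries the number \<open>s + 1\<close>.\<close>
  have "(?f w ! (j - 1) = i) = (source w (j - 1) = i - 1)" if "w \<in> words a n" for w
    using src[OF that] assms by (auto simp del: upt_Suc)
  then have ev: "words a n \<inter> {w. ?f w ! (j - 1) = i} = {w \<in> words a n. source w (j - 1) = i - 1}"
    by blast
  have "move_prob n a i j = measure_pmf.prob (pmf_of_set (words a n)) {w. ?f w ! (j - 1) = i}"
    unfolding move_prob_def a_shuffle_eq_uniform_words[OF assms(2)]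
    by (simp add: vimage_def del: upt_Suc)
  also have "\<dots> = 1 / real a ^ n * real (card {w \<in> words a n. source w (j - 1) = i - 1})"
    unfolding measure_pmf_of_set[OF ne finite_words] ev card_words by simp
  also have "real (card {w \<in> words a n. source w (j - 1) = i - 1}) =
      (\<Sum>k<a. \<Sum>r\<in>?R. real ((j - 1) choose r) * real ((n - j) choose (i - r - 1))
        * real (Suc k) ^ r * real (a - Suc k) ^ (j - 1 - r)
        * real (Suc k - 1) ^ (i - 1 - r) * real (a - Suc k + 1) ^ ((n - j) - (i - r - 1)))"
    unfolding card_source_eq[OF assms(3,5,6)] of_nat_sum
  proof (intro sum.cong refl)
    fix k r assume "k \<in> {..<a}"
    then have "{s. s < a \<and> s \<le> k} = {..k}" "{s. s < a \<and> \<not> s \<le> k} = {Suc k..<a}"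
      "{s. s < a \<and> s < k} = {..<k}" "{s. s < a \<and> \<not> s < k} = {k..<a}"
      by auto
    moreover have "i - r - 1 = i - 1 - r" "a - Suc k + 1 = a - k"
      using \<open>k \<in> {..<a}\<close> by auto
    ultimately show "real (card (words_with a (j - 1) (\<lambda>q. q \<le> k) r) *
        card (words_with a (n - j) (\<lambda>q. q < k) (i - 1 - r))) =
      real ((j - 1) choose r) * real ((n - j) choose (i - r - 1))
        * real (Suc k) ^ r * real (a - Suc k) ^ (j - 1 - r)
        * real (Suc k - 1) ^ (i - 1 - r) * real (a - Suc k + 1) ^ ((n - j) - (i - r - 1))"
      by (simp only: card_words_with) simp
  qed
  also have "\<dots> = (\<Sum>k=1..a. \<Sum>r\<in>?R. real ((j - 1) choose r) * real ((n - j) choose (i - r - 1))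
      * real k ^ r * real (a - k) ^ (j - 1 - r)
      * real (k - 1) ^ (i - 1 - r) * real (a - k + 1) ^ ((n - j) - (i - r - 1)))"
    \<comment> \<open>Labels start at 0, packet numbers at 1.\<close>
    by (rule sum.reindex_bij_witness[of _ "\<lambda>k. k - 1" Suc]) auto
  finally show ?thesis .
qed

end
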